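(* Let $k\ge 0$ and $l>0$ be integers, and let $\Gamma_k^l\subseteq F$ be the set of elements of Thompson's group $F$ which can be expressed in the form $wv$, where $w$ is a positive word of length $\le k$ in $\{x_0,x_1,x_2,\dots\}$ and $v$ is a positive word (of any length) in $\{x_0,\dots,x_l\}$. If $F$ is amenable, then for any right-invariant measure $\mu$ on $F$, $\mu(\Gamma_k^l)=0$.
   Context: Thompson's group $F$ is the group with presentation $\langle x_0,x_1,x_2,\dots \mid x_ix_j=x_jx_{i-1}\ \text{for all } i>j+1\rangle$. A positive word is a (possibly empty) word in the indicated generators using no inverses. A right-invariant measure on a group $G$ is a function $\mu$ from the set of all subsets of $G$ to $[0,1]$ such that $\mu(G)=1$, $\mu(A\cup B)=\mu(A)+\mu(B)$ for disjoint $A,B\subseteq G$, and $\mu(Ag)=\mu(A)$ for all $g\in G$, $A\subseteq G$. $G$ is amenable if such a measure exists (equivalently, if a left-invariant one exists). *)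

theory Defs
  imports Complex_Main "HOL-Algebra.Coset"
begin

text \<open>A letter \<open>(x, True)\<close> is the generator \<open>x\<close>, and \<open>(x, False)\<close> is its formal inverse.
  A relation \<open>u = v\<close> is a pair \<open>(u, v)\<close> of words; all elements of the type \<open>'x\<close> are generators.\<close>

type_synonym 'x group_word = "('x \<times> bool) list"

inductive_set word_cong :: "('x group_word \<times> 'x group_word) set \<Rightarrow> ('x group_word \<times> 'x group_word) set"
  for R where
    refl: "(u, u) \<in> word_cong R"
  | sym: "(u, v) \<in> word_cong R \<Longrightarrow> (v, u) \<in> word_cong R"
  | trans: "(u, v) \<in> word_cong R \<Longrightarrow> (v, w) \<in> word_cong R \<Longrightarrow> (u, w) \<in> word_cong R"
  | append: "(u, u') \<in> word_cong R \<Longrightarrow> (v, v') \<in> word_cong R \<Longrightarrow> (u @ v, u' @ v') \<in> word_cong R"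
  | cancel: "([(x, b), (x, \<not> b)], []) \<in> word_cong R"
  | relation: "(u, v) \<in> R \<Longrightarrow> (u, v) \<in> word_cong R"

definition word_class :: "('x group_word \<times> 'x group_word) set \<Rightarrow> 'x group_word \<Rightarrow> 'x group_word set" where
  "word_class R u = word_cong R `` {u}"

definition presented_group :: "('x group_word \<times> 'x group_word) set \<Rightarrow> 'x group_word set monoid" where
  "presented_group R =
     \<lparr>carrier = UNIV // word_cong R,
      monoid.mult = (\<lambda>A B. \<Union>u\<in>A. \<Union>v\<in>B. word_class R (u @ v)),
      one = word_class R []\<rparr>"

lemma equiv_word_cong: "equiv UNIV (word_cong R)"
proof (rule equivI)
  show "refl (word_cong R)"
    by (rule reflI) (rule word_cong.refl)
  show "sym (word_cong R)"
    by (rule symI) (rule word_cong.sym)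
  show "trans (word_cong R)"
    by (rule transI) (rule word_cong.trans)
qed simp

lemma word_class_eq_iff: "word_class R u = word_class R v \<longleftrightarrow> (u, v) \<in> word_cong R"
  unfolding word_class_def using equiv_word_cong[of R] by (simp add: eq_equiv_class_iff)

lemma carrier_presented_group: "carrier (presented_group R) = range (word_class R)"
  by (auto simp: presented_group_def quotient_def word_class_def)

lemma one_presented_group: "\<one>\<^bsub>presented_group R\<^esub> = word_class R []"
  by (simp add: presented_group_def)

lemma mult_presented_group:
  "word_class R u \<otimes>\<^bsub>presented_group R\<^esub> word_class R v = word_class R (u @ v)"
proof -
  have *: "word_class R (u' @ v') = word_class R (u @ v)"
    if "u' \<in> word_class R u" "v' \<in> word_class R v" for u' v'
  proof -
    have "(u, u') \<in> word_cong R" "(v, v') \<in> word_cong R"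
      using that by (simp_all add: word_class_def)
    then have "(u @ v, u' @ v') \<in> word_cong R"
      by (rule word_cong.append)
    then show ?thesis
      unfolding word_class_eq_iff by (rule word_cong.sym)
  qed
  have "u \<in> word_class R u" "v \<in> word_class R v"
    by (simp_all add: word_class_def word_cong.refl)
  then have "(\<Union>u'\<in>word_class R u. \<Union>v'\<in>word_class R v. word_class R (u' @ v')) =
      word_class R (u @ v)"
    using * by blast
  then show ?thesis
    by (simp add: presented_group_def)
qed

lemma word_cong_inverse:
  "(map (\<lambda>(x, b). (x, \<not> b)) (rev u) @ u, []) \<in> word_cong R"
proof (induction u)
  case Nil
  show ?case by (simp add: word_cong.refl)
next
  case (Cons a u)
  obtain x b where a: "a = (x, b)" by (cases a)
  have "([(x, \<not> b), (x, b)] @ u, [] @ u) \<in> word_cong R"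
    using word_cong.cancel[of x "\<not> b" R] by (intro word_cong.append[OF _ word_cong.refl]) simp
  then have "(map (\<lambda>(x, b). (x, \<not> b)) (rev u) @ [(x, \<not> b), (x, b)] @ u,
      map (\<lambda>(x, b). (x, \<not> b)) (rev u) @ [] @ u) \<in> word_cong R"
    by (rule word_cong.append[OF word_cong.refl])
  then have "(map (\<lambda>(x, b). (x, \<not> b)) (rev (a # u)) @ a # u,
      map (\<lambda>(x, b). (x, \<not> b)) (rev u) @ u) \<in> word_cong R"
    by (simp add: a)
  then show ?case
    using Cons.IH by (rule word_cong.trans)
qed

theorem group_presented_group: "group (presented_group R)"
proof (rule groupI)
  fix A assume "A \<in> carrier (presented_group R)"
  then obtain u where "A = word_class R u"
    by (auto simp: carrier_presented_group)
  then have "word_class R (map (\<lambda>(x, b). (x, \<not> b)) (rev u)) \<otimes>\<^bsub>presented_group R\<^esub> A =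
      \<one>\<^bsub>presented_group R\<^esub>"
    using word_cong_inverse[of u R]
    by (simp only: mult_presented_group one_presented_group word_class_eq_iff)
  then show "\<exists>B \<in> carrier (presented_group R).
      B \<otimes>\<^bsub>presented_group R\<^esub> A = \<one>\<^bsub>presented_group R\<^esub>"
    unfolding carrier_presented_group by blast
qed (auto simp: carrier_presented_group mult_presented_group one_presented_group)

definition thompson_relations :: "(nat group_word \<times> nat group_word) set" where
  "thompson_relations =
     {([(i, True), (j, True)], [(j, True), (i - 1, True)]) | i j. i > j + 1}"

definition thompson_F :: "nat group_word set monoid" where
  "thompson_F = presented_group thompson_relations"

text \<open>A positive word \<open>x\<^bsub>i\<^sub>1\<^esub> \<dots> x\<^bsub>i\<^sub>n\<^esub>\<close> is represented by its list of indices
  \<open>[i\<^sub>1, \<dots>, i\<^sub>n]\<close>; \<open>positive_element\<close> is the element of the group which it expresses.\<close>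

definition positive_element :: "nat list \<Rightarrow> nat group_word set" where
  "positive_element w = word_class thompson_relations (map (\<lambda>i. (i, True)) w)"

definition Gamma :: "nat \<Rightarrow> nat \<Rightarrow> nat group_word set set" where
  "Gamma k l =
     {positive_element w \<otimes>\<^bsub>thompson_F\<^esub> positive_element v | w v.
        length w \<le> k \<and> set v \<subseteq> {0..l}}"

text \<open>Measures are only finitely additive. Values of \<open>\<mu>\<close> outside
  \<open>Pow (carrier G)\<close> are unconstrained.\<close>

definition right_invariant_measure :: "('a, 'b) monoid_scheme \<Rightarrow> ('a set \<Rightarrow> real) \<Rightarrow> bool" where
  "right_invariant_measure G \<mu> \<longleftrightarrow>
     \<mu> \<in> Pow (carrier G) \<rightarrow> {0..1} \<and>
     \<mu> (carrier G) = 1 \<and>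
     (\<forall>A B. A \<subseteq> carrier G \<longrightarrow> B \<subseteq> carrier G \<longrightarrow> A \<inter> B = {} \<longrightarrow> \<mu> (A \<union> B) = \<mu> A + \<mu> B) \<and>
     (\<forall>A g. A \<subseteq> carrier G \<longrightarrow> g \<in> carrier G \<longrightarrow> \<mu> (A #>\<^bsub>G\<^esub> g) = \<mu> A)"

definition amenable :: "('a, 'b) monoid_scheme \<Rightarrow> bool" where
  "amenable G \<longleftrightarrow> (\<exists>\<mu>. right_invariant_measure G \<mu>)"

end

theory Submission
  imports Defs
begin

text \<open>A set \<open>A\<close> of a group with two disjoint right translates \<open>Ag\<close>, \<open>Ah\<close> inside \<open>A\<close> satisfies
  \<open>2 \<mu>(A) \<le> \<mu>(A)\<close>. For \<open>A = \<Gamma>\<^sub>k\<^sup>l\<close> take \<open>g = x\<^sub>0\<close> and \<open>h = x\<^sub>l\<^bsup>k+1\<^esup>\<close>. Regard positive elements as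
  binary forests, where \<open>x\<^sub>i\<close> joins the trees \<open>i\<close> and \<open>i + 1\<close> by a caret. In a forest from \<open>\<Gamma>\<^sub>k\<^sup>l\<close>, the
  tree at position \<open>l + 1\<close> has at most \<open>k\<close> carets, because a caret added by \<open>x\<^sub>i\<close> with
  \<open>i \<le> l\<close> ends up in a tree at position at most \<open>l\<close>. After multiplication by \<open>x\<^sub>0\<close> this tree is at position \<open>l\<close>, whereas every
  forest in \<open>\<Gamma>\<^sub>k\<^sup>l h\<close> has more than \<open>k\<close> carets there. The caret counts are read off from the action
  of \<open>F\<close> on the line by piecewise linear maps, as lengths of images of unit intervals minus one.\<close>

lemma right_invariant_measure_nonneg:
  assumes "right_invariant_measure G \<mu>" "A \<subseteq> carrier G"
  shows "0 \<le> \<mu> A"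
proof -
  have "\<mu> \<in> Pow (carrier G) \<rightarrow> {0..1}"
    using assms(1) by (simp only: right_invariant_measure_def)
  then have "\<mu> A \<in> {0..1}"
    by (rule funcset_mem) (simp add: assms(2))
  then show ?thesis
    by simp
qed

lemma right_invariant_measure_Un:
  assumes "right_invariant_measure G \<mu>" "A \<subseteq> carrier G" "B \<subseteq> carrier G" "A \<inter> B = {}"
  shows "\<mu> (A \<union> B) = \<mu> A + \<mu> B"
  using assms by (simp add: right_invariant_measure_def)

lemma right_invariant_measure_r_coset:
  assumes "right_invariant_measure G \<mu>" "A \<subseteq> carrier G" "g \<in> carrier G"
  shows "\<mu> (A #>\<^bsub>G\<^esub> g) = \<mu> A"
  using assms by (simp add: right_invariant_measure_def)

lemma right_invariant_measure_mono:
  assumes "right_invariant_measure G \<mu>" "B \<subseteq> A" "A \<subseteq> carrier G"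
  shows "\<mu> B \<le> \<mu> A"
proof -
  have carr: "B \<subseteq> carrier G" "A - B \<subseteq> carrier G"
    using assms(2,3) by auto
  have "\<mu> (B \<union> (A - B)) = \<mu> B + \<mu> (A - B)"
    by (rule right_invariant_measure_Un[OF assms(1) carr Diff_disjoint])
  moreover have "0 \<le> \<mu> (A - B)"
    by (rule right_invariant_measure_nonneg[OF assms(1) carr(2)])
  moreover have "B \<union> (A - B) = A"
    using assms(2) by blast
  ultimately show ?thesis
    by simp
qed

lemma right_invariant_measure_zero_if_disjoint_translates:
  assumes \<mu>: "right_invariant_measure G \<mu>"
    and A: "A \<subseteq> carrier G" and gh: "g \<in> carrier G" "h \<in> carrier G"
    and sub: "A #>\<^bsub>G\<^esub> g \<subseteq> A" "A #>\<^bsub>G\<^esub> h \<subseteq> A"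
    and disj: "(A #>\<^bsub>G\<^esub> g) \<inter> (A #>\<^bsub>G\<^esub> h) = {}"
  shows "\<mu> A = 0"
proof -
  have "\<mu> A + \<mu> A = \<mu> (A #>\<^bsub>G\<^esub> g) + \<mu> (A #>\<^bsub>G\<^esub> h)"
    using right_invariant_measure_r_coset[OF \<mu> A] gh by simp
  also have "\<dots> = \<mu> ((A #>\<^bsub>G\<^esub> g) \<union> (A #>\<^bsub>G\<^esub> h))"
    using right_invariant_measure_Un[OF \<mu> subset_trans[OF sub(1) A] subset_trans[OF sub(2) A] disj]
    by (rule HOL.sym)
  also have "\<dots> \<le> \<mu> A"
    using sub by (intro right_invariant_measure_mono[OF \<mu> _ A]) simp
  finally show ?thesis
    using right_invariant_measure_nonneg[OF \<mu> A] by simp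
qed

definition stretch :: "nat \<Rightarrow> real \<Rightarrow> real" where
  "stretch i t = (if t \<le> i then t else if t \<le> i + 1 then 2 * t - i else t + 1)"

definition shrink :: "nat \<Rightarrow> real \<Rightarrow> real" where
  "shrink i t = (if t \<le> i then t else if t \<le> i + 2 then (t + i) / 2 else t - 1)"

lemma shrink_stretch: "shrink i (stretch i t) = t"
  by (auto simp: shrink_def stretch_def)

lemma stretch_shrink: "stretch i (shrink i t) = t"
  by (auto simp: shrink_def stretch_def field_simps)

text \<open>The interval \<open>[i - 1, i]\<close> lies to the right of \<open>[j, j + 1]\<close>,
  so \<open>stretch j\<close> translates it by one, onto the interval that \<open>stretch i\<close>
  doubles.\<close>

lemma stretch_relation:
  assumes "i > j + 1"
  shows "stretch i (stretch j t) = stretch j (stretch (i - 1) t)"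
proof -
  have "real (i - 1) = real i - 1" "real i \<ge> real j + 2"
    using assms by auto
  then show ?thesis
    by (auto simp: stretch_def)
qed

definition word_action :: "nat group_word \<Rightarrow> real \<Rightarrow> real" where
  "word_action = foldr (\<lambda>(i, b). if b then stretch i else shrink i)"

lemma word_action_append: "word_action (u @ v) t = word_action u (word_action v t)"
  by (simp add: word_action_def)

lemma word_action_cong:
  assumes "(u, v) \<in> word_cong thompson_relations"
  shows "word_action u t = word_action v t"
  using assms
proof (induction arbitrary: t rule: word_cong.induct)
  case (cancel x b)
  show ?case
    by (cases b) (simp_all add: word_action_def shrink_stretch stretch_shrink)
next
  case (relation u v)
  then show ?case
    by (auto simp: thompson_relations_def word_action_def stretch_relation)
qed (simp_all add: word_action_append)

text \<open>In the forest of \<open>w\<close>, the tree at position \<open>n\<close> has the leaves from \<open>leaf_index w n\<close> up to,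
  but excluding, \<open>leaf_index w (Suc n)\<close>.\<close>

definition leaf_index :: "nat list \<Rightarrow> nat \<Rightarrow> nat" where
  "leaf_index = foldr (\<lambda>i n. if n \<le> i then n else Suc n)"

lemma word_action_positive:
  "word_action (map (\<lambda>i. (i, True)) w) (real n) = real (leaf_index w n)"
  by (induction w) (auto simp: word_action_def leaf_index_def stretch_def)

lemma positive_element_eq_imp_leaf_index_eq:
  assumes "positive_element u = positive_element v"
  shows "leaf_index u n = leaf_index v n"
proof -
  have "(map (\<lambda>i. (i, True)) u, map (\<lambda>i. (i, True)) v) \<in> word_cong thompson_relations"
    using assms by (simp add: positive_element_def word_class_eq_iff)
  from word_action_cong[OF this, of "real n"] show ?thesis
    by (simp add: word_action_positive)
qed

lemma leaf_index_append: "leaf_index (u @ v) n = leaf_index u (leaf_index v n)"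
  by (simp add: leaf_index_def)

text \<open>Each letter acts on indices by a strictly increasing map.\<close>

lemma leaf_index_expanding: "m \<le> n \<Longrightarrow> leaf_index w m + (n - m) \<le> leaf_index w n"
  by (induction w) (auto simp: leaf_index_def)

text \<open>Each letter widens a gap by at most one.\<close>

lemma leaf_index_growth:
  "m \<le> n \<Longrightarrow> leaf_index w n \<le> leaf_index w m + (n - m) + length w"
  by (induction w) (auto simp: leaf_index_def)

text \<open>Indices above \<open>l\<close> stay above \<open>l\<close>, so every letter of
  \<open>v\<close> shifts them by one.\<close>

lemma leaf_index_beyond:
  "set v \<subseteq> {0..l} \<Longrightarrow> l < n \<Longrightarrow> leaf_index v n = n + length v"
  by (induction v) (auto simp: leaf_index_def)

lemma leaf_index_replicate:
  "leaf_index (replicate m l) l = l" "leaf_index (replicate m l) (Suc l) = Suc l + m"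
  by (induction m) (auto simp: leaf_index_def)

lemma mult_positive_element:
  "positive_element u \<otimes>\<^bsub>thompson_F\<^esub> positive_element v = positive_element (u @ v)"
  by (simp add: positive_element_def thompson_F_def mult_presented_group)

lemma positive_element_closed: "positive_element w \<in> carrier thompson_F"
  by (simp add: positive_element_def thompson_F_def carrier_presented_group)

lemma Gamma_eq:
  "Gamma k l = {positive_element (w @ v) | w v. length w \<le> k \<and> set v \<subseteq> {0..l}}"
  by (simp add: Gamma_def mult_positive_element)

lemma r_coset_Gamma:
  "Gamma k l #>\<^bsub>thompson_F\<^esub> positive_element y =
    {positive_element (w @ v @ y) | w v. length w \<le> k \<and> set v \<subseteq> {0..l}}"
  by (force simp: Gamma_eq r_coset_def mult_positive_element)

text \<open>The word \<open>y\<close> is absorbed into the factor \<open>v\<close>, whose length is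
  unbounded.\<close>

lemma r_coset_Gamma_subset:
  assumes "set y \<subseteq> {0..l}"
  shows "Gamma k l #>\<^bsub>thompson_F\<^esub> positive_element y \<subseteq> Gamma k l"
proof
  fix a assume "a \<in> Gamma k l #>\<^bsub>thompson_F\<^esub> positive_element y"
  then obtain w v where "a = positive_element (w @ (v @ y))" "length w \<le> k" "set v \<subseteq> {0..l}"
    by (auto simp: r_coset_Gamma)
  moreover from this have "set (v @ y) \<subseteq> {0..l}"
    using assms by simp
  ultimately show "a \<in> Gamma k l"
    unfolding Gamma_eq by blast
qed

lemma r_cosets_Gamma_disjoint:
  assumes "l > 0"
  shows "(Gamma k l #>\<^bsub>thompson_F\<^esub> positive_element [0]) \<inter>
    (Gamma k l #>\<^bsub>thompson_F\<^esub> positive_element (replicate (Suc k) l)) = {}"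
proof (rule ccontr)
  assume "\<not> ?thesis"
  then obtain w v w' v' where w: "length w \<le> k" and v: "set v \<subseteq> {0..l}"
    and eq: "positive_element (w @ v @ [0]) = positive_element (w' @ v' @ replicate (Suc k) l)"
    by (auto simp: r_coset_Gamma)
  let ?f = "leaf_index (w @ v @ [0])"
  \<comment> \<open>As \<open>l > 0\<close>, the letter \<open>0\<close> moves both \<open>l\<close>
    and \<open>Suc l\<close> above \<open>l\<close>; then \<open>v\<close> only translates, and
    \<open>w\<close> alone can widen the gap.\<close>
  have "leaf_index [0] l = Suc l" "leaf_index [0] (Suc l) = Suc (Suc l)"
    using assms by (simp_all add: leaf_index_def)
  then have "?f l = leaf_index w (Suc l + length v)"
    "?f (Suc l) = leaf_index w (Suc (Suc l) + length v)"
    using leaf_index_beyond[OF v] by (simp_all add: leaf_index_append)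
  then have upper: "?f (Suc l) \<le> ?f l + Suc k"
    using leaf_index_growth[of "Suc l + length v" "Suc (Suc l) + length v" w] w by simp
  have "?f n = leaf_index (w' @ v') (leaf_index (replicate (Suc k) l) n)" for n
    using positive_element_eq_imp_leaf_index_eq[OF eq]
    by (simp only: leaf_index_append)
  then have "?f l = leaf_index (w' @ v') l" "?f (Suc l) = leaf_index (w' @ v') (Suc l + Suc k)"
    by (simp_all only: leaf_index_replicate)
  \<comment> \<open>The gap is already \<open>Suc (Suc k)\<close> before \<open>w' @ v'\<close>
    acts, and it cannot shrink.\<close>
  then have "?f l + Suc (Suc k) \<le> ?f (Suc l)"
    using leaf_index_expanding[of l "Suc l + Suc k" "w' @ v'"] by simp
  with upper show False
    by simp
qed

theorem corollary4p5:
  fixes k l :: nat and \<mu> :: "nat group_word set set \<Rightarrow> real"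
  assumes "l > 0"
    and "amenable thompson_F"
    and "right_invariant_measure thompson_F \<mu>"
  shows "\<mu> (Gamma k l) = 0"
proof (rule right_invariant_measure_zero_if_disjoint_translates[OF assms(3)])
  show "Gamma k l \<subseteq> carrier thompson_F"
    by (auto simp: Gamma_eq positive_element_closed)
  show "Gamma k l #>\<^bsub>thompson_F\<^esub> positive_element [0] \<subseteq> Gamma k l"
    "Gamma k l #>\<^bsub>thompson_F\<^esub> positive_element (replicate (Suc k) l) \<subseteq> Gamma k l"
    by (rule r_coset_Gamma_subset; auto)+
qed (use r_cosets_Gamma_disjoint[OF assms(1)] positive_element_closed in auto)

end
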